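(* If $\mathcal F$ is a 2-intersecting family in a (finite) Minkowski plane of order $q>2$, then $|\mathcal F| \leq (q+1)\frac{q-2}{2}$.
   Context: All incidence structures are finite. An incidence structure $(\mathcal P, \mathcal B)$ consists of a set $\mathcal P$ of points and a set $\mathcal B$ of subsets of $\mathcal P$, here called circles. A parallel relation is a partition of $\mathcal P$ into parallel classes; two points are parallel with respect to it if they are in the same parallel class. Consider an incidence structure with two parallel relations such that any two distinct points are parallel with respect to at most one of them. For a point $P \in \mathcal P$, the residue at $P$ is the incidence structure $(\mathcal P_P, \mathcal B_P)$, where $\mathcal P_P$ is the set of points not parallel to $P$ (with respect to either relation) and $\mathcal B_P = \{ B \cap \mathcal P_P : B \in \mathcal B'_P\}$, with $\mathcal B'_P$ the set consisting of all circles through $P$ and all parallel classes (of both relations) not containing $P$. A Minkowski plane is such an incidence structure with two parallel relations for which the residue at each point is an affine plane. Characteristic properties: every three pairwise non-parallel points lie on a unique circle; given two non-parallel points $P$ and $Q$ and a circle $c$ through $P$ but not through $Q$, there is a unique circle through $P$ and $Q$ which intersects $c$ only in $P$; every circle meets every parallel class in exactly one point. The residues all have the same order $q$ as affine planes, and this $q$ is called the order of the Minkowski plane; then every circle has $q+1$ points, every point lies on $q(q-1)$ circles, every parallel class has $q+1$ points, $|\mathcal P| = (q+1)^2$ and $|\mathcal B| = (q-1)q(q+1)$. A 2-intersecting family is a set $\mathcal F \subseteq \mathcal B$ of circles any two of which have at least two points in common. *)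

theory Defs
  imports Complex_Main "HOL-Library.Disjoint_Sets"
begin

locale incidence_structure =
  fixes points :: "'a set" and blocks :: "'a set set"
  assumes finite_points: "finite points"
    and blocks_subset: "blocks \<subseteq> Pow points"

locale affine_plane = incidence_structure points lines
  for points :: "'a set" and lines :: "'a set set" +
  assumes unique_line:
      "\<lbrakk>x \<in> points; y \<in> points; x \<noteq> y\<rbrakk> \<Longrightarrow> \<exists>!l. l \<in> lines \<and> x \<in> l \<and> y \<in> l"
    and playfair:
      "\<lbrakk>l \<in> lines; x \<in> points; x \<notin> l\<rbrakk> \<Longrightarrow> \<exists>!m. m \<in> lines \<and> x \<in> m \<and> m \<inter> l = {}"
    and three_noncollinear:
      "\<exists>x\<in>points. \<exists>y\<in>points. \<exists>z\<in>points. x \<noteq> y \<and> x \<noteq> z \<and> y \<noteq> z \<and>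
         \<not> (\<exists>l\<in>lines. x \<in> l \<and> y \<in> l \<and> z \<in> l)"

definition affine_plane_of_order :: "'a set \<Rightarrow> 'a set set \<Rightarrow> nat \<Rightarrow> bool" where
  "affine_plane_of_order points lines q \<longleftrightarrow>
     affine_plane points lines \<and> (\<forall>l\<in>lines. card l = q)"

definition parallel :: "'a set set \<Rightarrow> 'a \<Rightarrow> 'a \<Rightarrow> bool" where
  "parallel classes x y \<longleftrightarrow> (\<exists>g\<in>classes. x \<in> g \<and> y \<in> g)"

definition residue_points ::
    "'a set \<Rightarrow> 'a set set \<Rightarrow> 'a set set \<Rightarrow> 'a \<Rightarrow> 'a set" where
  "residue_points points classes1 classes2 p =
     {x \<in> points. \<not> parallel classes1 p x \<and> \<not> parallel classes2 p x}"

definition residue_blocks ::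
    "'a set \<Rightarrow> 'a set set \<Rightarrow> 'a set set \<Rightarrow> 'a set set \<Rightarrow> 'a \<Rightarrow> 'a set set" where
  "residue_blocks points circles classes1 classes2 p =
     (\<lambda>b. b \<inter> residue_points points classes1 classes2 p) `
       ({c \<in> circles. p \<in> c} \<union> {g \<in> classes1 \<union> classes2. p \<notin> g})"

text \<open>
  The condition on residues alone does not determine the circles: the residues form sets of
  traces, so they do not see an empty circle, nor a ``circle'' \<open>g \<union> h\<close> with \<open>g\<close> and \<open>h\<close> two
  distinct classes of one parallel relation (at a point of \<open>g\<close> it has the same trace as \<open>h\<close>).
  Such circles are excluded by the characteristic property that every circle meets every
  parallel class in exactly one point.  The other characteristic properties then follow.
\<close>

locale minkowski_plane = incidence_structure points circles
  for points :: "'a set" and circles :: "'a set set" +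
  fixes classes1 classes2 :: "'a set set"
  assumes partition1: "partition_on points classes1"
    and partition2: "partition_on points classes2"
    and at_most_one_parallel:
      "\<lbrakk>x \<in> points; y \<in> points; x \<noteq> y\<rbrakk> \<Longrightarrow> \<not> (parallel classes1 x y \<and> parallel classes2 x y)"
    and points_nonempty: "points \<noteq> {}"
    and circle_meets_class:
      "\<lbrakk>c \<in> circles; g \<in> classes1 \<union> classes2\<rbrakk> \<Longrightarrow> \<exists>!x. x \<in> c \<inter> g"
    and residue_affine:
      "p \<in> points \<Longrightarrow>
         affine_plane (residue_points points classes1 classes2 p)
           (residue_blocks points circles classes1 classes2 p)"

definition minkowski_plane_of_order ::
    "'a set \<Rightarrow> 'a set set \<Rightarrow> 'a set set \<Rightarrow> 'a set set \<Rightarrow> nat \<Rightarrow> bool" where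
  "minkowski_plane_of_order points circles classes1 classes2 q \<longleftrightarrow>
     minkowski_plane points circles classes1 classes2 \<and>
     (\<forall>p\<in>points. affine_plane_of_order (residue_points points classes1 classes2 p)
        (residue_blocks points circles classes1 classes2 p) q)"

definition two_intersecting_family :: "'a set set \<Rightarrow> 'a set set \<Rightarrow> bool" where
  "two_intersecting_family circles F \<longleftrightarrow>
     F \<subseteq> circles \<and> (\<forall>c\<in>F. \<forall>d\<in>F. c \<noteq> d \<longrightarrow> 2 \<le> card (c \<inter> d))"

end

theory Submission
  imports Defs
begin

text \<open>
  Two distinct circles share at most two points, so the circles of a 2-intersecting family \<open>F\<close> of
  \<open>f\<close> circles meet pairwise in exactly two points.  Write \<open>r\<^sub>Q\<close> for the number of circles of \<open>F\<close>
  through \<open>Q\<close>.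

  The traces of the circles of \<open>F\<close> through \<open>P\<close> are pairwise intersecting lines of the residue at
  \<open>P\<close>, hence lie in different directions.  There are \<open>q + 1\<close> directions, and two of them belong to
  the parallel classes, so \<open>r\<^sub>P \<le> q - 1\<close> (\<open>card_pencil_le\<close>).  Counting incidences along one circle
  \<open>c\<close> of \<open>F\<close> gives \<open>q + 1 + 2 (f - 1) = (\<Sum>P\<in>c. r\<^sub>P) \<le> (q + 1) (q - 1)\<close>, that is,
  \<open>2 f \<le> q\<^sup>2 - q\<close>.  This exceeds the claimed bound \<open>2 f \<le> q\<^sup>2 - q - 2\<close> by a single circle,
  so it remains to exclude equality.

  In the case of equality \<open>r\<^sub>Q = q - 1\<close> for every point \<open>Q\<close> covered by \<open>F\<close>.  Fix such a point \<open>P\<close>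
  and let \<open>\<lambda>\<^sub>Q\<close> count the circles of \<open>F\<close> through both \<open>P\<close> and \<open>Q\<close>.  Standard counts over the
  residue at \<open>P\<close> give
  \<open>(\<Sum>Q. \<lambda>\<^sub>Q) = (q - 1) q\<close>, \<open>(\<Sum>Q. \<lambda>\<^sub>Q\<^sup>2) = (q - 1) (2 q - 2)\<close> and
  \<open>(\<Sum>Q. r\<^sub>Q) = (q - 1) (f + 1)\<close>; the last one says that \<open>f + 1\<close> points of the residue are covered.
  Summing \<open>(\<lambda>\<^sub>Q - 1) (\<lambda>\<^sub>Q - 2) \<ge> 0\<close> over these points yields \<open>4 - 2 q \<ge> 0\<close>, contrary to
  \<open>q > 2\<close>.
\<close>

section \<open>Pencils and double counting\<close>

definition pencil :: "'a set set \<Rightarrow> 'a \<Rightarrow> 'a set set" where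
  "pencil F p = {c \<in> F. p \<in> c}"

lemma pencil_subset: "pencil F p \<subseteq> F"
  by (auto simp: pencil_def)

lemma sum_card_pencil:
  assumes "finite A" "finite G"
  shows "(\<Sum>x\<in>A. card (pencil G x)) = (\<Sum>d\<in>G. card (d \<inter> A))"
proof -
  have "(\<Sum>x\<in>A. card (pencil G x)) = (\<Sum>x\<in>A. \<Sum>d\<in>G. if x \<in> d then 1 else 0)"
    using assms by (simp add: pencil_def sum.If_cases Int_def)
  also have "\<dots> = (\<Sum>d\<in>G. \<Sum>x\<in>A. if x \<in> d then 1 else 0)"
    by (rule sum.swap)
  also have "\<dots> = (\<Sum>d\<in>G. card (d \<inter> A))"
    using assms by (simp add: sum.If_cases Int_def conj_commute)
  finally show ?thesis .
qed

lemma sum_card_pencil_squared: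
  assumes "finite A" "finite G"
  shows "(\<Sum>x\<in>A. (card (pencil G x))\<^sup>2) = (\<Sum>d\<in>G. \<Sum>e\<in>G. card (d \<inter> e \<inter> A))"
proof -
  have "(\<Sum>x\<in>A. (card (pencil G x))\<^sup>2)
      = (\<Sum>x\<in>A. \<Sum>d\<in>G. if x \<in> d then card (pencil G x) else 0)"
    using assms by (simp add: pencil_def sum.If_cases Int_def power2_eq_square)
  also have "\<dots> = (\<Sum>d\<in>G. \<Sum>x\<in>A. if x \<in> d then card (pencil G x) else 0)"
    by (rule sum.swap)
  also have "\<dots> = (\<Sum>d\<in>G. \<Sum>x\<in>A \<inter> d. card (pencil G x))"
    using assms by (simp add: sum.inter_restrict)
  also have "\<dots> = (\<Sum>d\<in>G. \<Sum>e\<in>G. card (d \<inter> e \<inter> A))"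
    using assms by (simp add: sum_card_pencil Int_ac)
  finally show ?thesis .
qed

section \<open>Pairwise intersecting lines of an affine plane\<close>

context affine_plane
begin

lemma parallel_lines_eq:
  assumes "m \<in> lines" "l \<in> lines" "k \<in> lines" "l \<inter> k \<noteq> {}"
    and "m = l \<or> m \<inter> l = {}" and "m = k \<or> m \<inter> k = {}"
  shows "l = k"
proof (cases "m = l \<or> m = k")
  case True
  then show ?thesis using assms by auto
next
  case False
  obtain z where z: "z \<in> l" "z \<in> k" using assms(4) by blast
  moreover have "z \<in> points" using z assms blocks_subset by auto
  moreover have "z \<notin> m" using False assms z by blast
  ultimately show ?thesis using playfair[of m z] False assms by (metis Int_commute)
qed

text \<open>
  Pairwise intersecting lines have different directions, and there are \<open>q + 1\<close> directions.  In
  terms of points: for a line \<open>l\<^sub>0\<close> and a point \<open>x\<close> off it, the parallel through \<open>x\<close> to another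
  line of the set cannot be parallel to \<open>l\<^sub>0\<close>, and its intersection with \<open>l\<^sub>0\<close> determines it, hence
  its direction, hence the line of the set.
\<close>

lemma card_pairwise_meeting_le:
  assumes order: "\<And>l. l \<in> lines \<Longrightarrow> card l = q"
    and L: "L \<subseteq> lines"
    and meet: "\<And>l k. \<lbrakk>l \<in> L; k \<in> L; l \<noteq> k\<rbrakk> \<Longrightarrow> l \<inter> k \<noteq> {}"
  shows "card L \<le> q + 1"
proof (cases "L = {}")
  case False
  then obtain l0 where l0: "l0 \<in> L" by blast
  then have l0': "l0 \<in> lines" using L by blast
  have finl0: "finite l0" using l0' blocks_subset finite_points finite_subset by blast
  have finL: "finite L"
    using L blocks_subset finite_points by (meson finite_Pow_iff finite_subset)
  obtain x where x: "x \<in> points" "x \<notin> l0" using three_noncollinear l0' by blast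
  have "\<forall>l\<in>L - {l0}. \<exists>y. y \<in> l0 \<and> (\<exists>m\<in>lines. x \<in> m \<and> y \<in> m \<and> (m = l \<or> m \<inter> l = {}))"
  proof
    fix l assume l: "l \<in> L - {l0}"
    then have l': "l \<in> lines" using L by blast
    obtain m where m: "m \<in> lines" "x \<in> m" "m = l \<or> m \<inter> l = {}"
      using playfair[of l x] l' x by blast
    have "m \<inter> l0 \<noteq> {}"
      using parallel_lines_eq[of m l l0] m l l' l0 l0' meet[of l l0] by blast
    then show "\<exists>y. y \<in> l0 \<and> (\<exists>m\<in>lines. x \<in> m \<and> y \<in> m \<and> (m = l \<or> m \<inter> l = {}))"
      using m by blast
  qed
  then obtain f where f: "\<forall>l\<in>L - {l0}. f l \<in> l0 \<and>
      (\<exists>m\<in>lines. x \<in> m \<and> f l \<in> m \<and> (m = l \<or> m \<inter> l = {}))"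
    by (rule bchoice[THEN exE])
  have inj: "inj_on f (L - {l0})"
  proof (rule inj_onI)
    fix l k assume lk: "l \<in> L - {l0}" "k \<in> L - {l0}" "f l = f k"
    obtain m where m: "m \<in> lines" "x \<in> m" "f l \<in> m" "m = l \<or> m \<inter> l = {}"
      using f lk by blast
    obtain n where n: "n \<in> lines" "x \<in> n" "f k \<in> n" "n = k \<or> n \<inter> k = {}"
      using f lk by blast
    have y: "f l \<in> l0" using f lk by blast
    then have "f l \<in> points" "x \<noteq> f l" using l0' blocks_subset x by auto
    then have "m = n" using unique_line[of x "f l"] x m n lk(3) by metis
    then show "l = k"
      using parallel_lines_eq[of m l k] m n lk L meet[of l k] by blast
  qed
  have "card (L - {l0}) \<le> card l0"
    using card_inj_on_le[OF inj _ finl0] f by blast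
  then show ?thesis using order[OF l0'] l0 finL by simp
qed simp

end

section \<open>Minkowski planes of a given order\<close>

locale minkowski_plane_with_order = minkowski_plane points circles classes1 classes2
  for points :: "'a set" and circles classes1 classes2 :: "'a set set" +
  fixes q :: nat
  assumes order: "\<lbrakk>p \<in> points; l \<in> residue_blocks points circles classes1 classes2 p\<rbrakk> \<Longrightarrow> card l = q"
    and order_gt_2: "q > 2"
begin

abbreviation Res :: "'a \<Rightarrow> 'a set" where
  "Res p \<equiv> residue_points points classes1 classes2 p"

abbreviation Lin :: "'a \<Rightarrow> 'a set set" where
  "Lin p \<equiv> residue_blocks points circles classes1 classes2 p"

lemma finite_Res: "finite (Res p)"
  using finite_points by (auto simp: residue_points_def)

lemma circle_subset: "c \<in> circles \<Longrightarrow> c \<subseteq> points"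
  using blocks_subset by blast

lemma finite_circle: "c \<in> circles \<Longrightarrow> finite c"
  using circle_subset finite_points finite_subset by blast

lemma finite_circles: "finite circles"
  using blocks_subset finite_points by (meson finite_Pow_iff finite_subset)

lemma ex_class1: "p \<in> points \<Longrightarrow> \<exists>g\<in>classes1. p \<in> g"
  and ex_class2: "p \<in> points \<Longrightarrow> \<exists>g\<in>classes2. p \<in> g"
  using partition1 partition2 by (auto simp: partition_on_def)

lemma parallel1_iff: "\<lbrakk>g \<in> classes1; p \<in> g\<rbrakk> \<Longrightarrow> parallel classes1 p x \<longleftrightarrow> x \<in> g"
  and parallel2_iff: "\<lbrakk>h \<in> classes2; p \<in> h\<rbrakk> \<Longrightarrow> parallel classes2 p x \<longleftrightarrow> x \<in> h"
  using partition_onD2[OF partition1] partition_onD2[OF partition2]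
  unfolding parallel_def disjoint_def by blast+

lemma circle_class_unique:
  assumes "c \<in> circles" "g \<in> classes1 \<union> classes2" "x \<in> c" "x \<in> g" "y \<in> c" "y \<in> g"
  shows "x = y"
  using circle_meets_class[OF assms(1,2)] assms by blast

lemma circle_class_meet:
  assumes "c \<in> circles" "g \<in> classes1 \<union> classes2"
  obtains x where "x \<in> c" "x \<in> g"
  using circle_meets_class[OF assms] by blast

lemma Res_eq:
  assumes "g \<in> classes1" "h \<in> classes2" "p \<in> g" "p \<in> h"
  shows "Res p = points - g - h"
  using assms by (auto simp: residue_points_def parallel1_iff parallel2_iff)

lemma circle_nonempty: "c \<in> circles \<Longrightarrow> \<exists>p. p \<in> c"
  using points_nonempty ex_class1 circle_class_meet by (metis UnI1 ex_in_conv)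

lemma trace_of_circle:
  assumes "c \<in> circles" "p \<in> c"
  shows "c \<inter> Res p = c - {p}"
proof -
  have p: "p \<in> points" using assms circle_subset by blast
  obtain g h where gh: "g \<in> classes1" "h \<in> classes2" "p \<in> g" "p \<in> h"
    using ex_class1[OF p] ex_class2[OF p] by blast
  show ?thesis
    using Res_eq[OF gh] circle_class_unique[OF assms(1), of g p]
      circle_class_unique[OF assms(1), of h p] gh assms circle_subset[OF assms(1)] by blast
qed

lemma circle_trace_line: "\<lbrakk>c \<in> circles; p \<in> c\<rbrakk> \<Longrightarrow> c - {p} \<in> Lin p"
  using trace_of_circle[of c p] unfolding residue_blocks_def by (intro image_eqI[of _ _ c]) auto

lemma class_trace_line: "\<lbrakk>g \<in> classes1 \<union> classes2; p \<notin> g\<rbrakk> \<Longrightarrow> g \<inter> Res p \<in> Lin p"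
  unfolding residue_blocks_def by (rule image_eqI[of _ _ g]) auto

lemma card_circle_minus: "\<lbrakk>c \<in> circles; p \<in> c\<rbrakk> \<Longrightarrow> card (c - {p}) = q"
  using order[OF _ circle_trace_line[of c p]] circle_subset by blast

lemma card_circle:
  assumes "c \<in> circles" shows "card c = q + 1"
proof -
  obtain p where p: "p \<in> c" using circle_nonempty assms by blast
  have "card (c - {p}) = card c - 1" "card c > 0"
    using p finite_circle[OF assms] card_gt_0_iff by auto
  then show ?thesis using card_circle_minus[OF assms p] by simp
qed

text \<open>
  A circle not through \<open>p\<close> loses exactly its intersections with the two parallel classes of \<open>p\<close>.
\<close>

lemma card_trace_off_point:
  assumes c: "c \<in> circles" and p: "p \<in> points" "p \<notin> c"
  shows "card (c \<inter> Res p) = q - 1"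
proof -
  obtain g h where gh: "g \<in> classes1" "h \<in> classes2" "p \<in> g" "p \<in> h"
    using ex_class1[OF p(1)] ex_class2[OF p(1)] by blast
  obtain a where a: "a \<in> c" "a \<in> g" using circle_class_meet[OF c, of g] gh by auto
  obtain b where b: "b \<in> c" "b \<in> h" using circle_class_meet[OF c, of h] gh by auto
  \<comment> \<open>A common point of both classes of \<open>p\<close> would be \<open>p\<close>, which is off \<open>c\<close>.\<close>
  have ab: "a \<noteq> b"
    using at_most_one_parallel[of p a] parallel1_iff[OF gh(1,3)] parallel2_iff[OF gh(2,4)]
      p a b circle_subset[OF c] by blast
  have "c \<inter> Res p = c - {a, b}"
    using Res_eq[OF gh] circle_class_unique[OF c, of g a] circle_class_unique[OF c, of h b]
      a b gh circle_subset[OF c] by blast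
  then show ?thesis using card_circle[OF c] ab a b by (simp add: card_Diff_subset)
qed

text \<open>
  In the residue at one common point, two further common points lie on only one line.
\<close>

lemma circles_eqI:
  assumes cd: "c \<in> circles" "d \<in> circles" and p: "p \<in> c" "p \<in> d"
    and x: "x \<in> c" "x \<in> d" and y: "y \<in> c" "y \<in> d" and ne: "x \<noteq> p" "y \<noteq> p" "x \<noteq> y"
  shows "c = d"
proof -
  have "p \<in> points" using cd p circle_subset by blast
  then interpret R: affine_plane "Res p" "Lin p" by (rule residue_affine)
  have "x \<in> Res p" "y \<in> Res p"
    using trace_of_circle[OF cd(1) p(1)] x y ne by auto
  then have "c - {p} = d - {p}"
    using R.unique_line[of x y] circle_trace_line[OF cd(1) p(1)] circle_trace_line[OF cd(2) p(2)]
      x y ne by (metis Diff_iff singletonD)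
  then show ?thesis using p by blast
qed

lemma card_circle_Int_le:
  assumes cd: "c \<in> circles" "d \<in> circles" "c \<noteq> d"
  shows "card (c \<inter> d) \<le> 2"
proof (rule ccontr)
  assume "\<not> card (c \<inter> d) \<le> 2"
  then have "Suc (Suc (Suc 0)) \<le> card (c \<inter> d)" by simp
  then obtain T where T: "T \<subseteq> c \<inter> d" "card T = 3"
    using obtain_subset_with_card_n[of 3 "c \<inter> d"] by (metis numeral_3_eq_3)
  then obtain x y z where "T = {x, y, z}" "x \<noteq> y" "y \<noteq> z" "x \<noteq> z"
    by (auto simp: card_3_iff)
  then show False using circles_eqI[of c d x y z] cd T by auto
qed

section \<open>Circles of a 2-intersecting family\<close>

lemma card_Int_eq_2:
  assumes "two_intersecting_family circles F" "c \<in> F" "d \<in> F" "c \<noteq> d"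
  shows "card (c \<inter> d) = 2"
  using assms card_circle_Int_le[of c d] unfolding two_intersecting_family_def
  by (metis le_antisym subsetD)

text \<open>
  Through a point \<open>x\<close> of the residue at \<open>p\<close> pass two traces of parallel classes.  They meet each
  other in \<open>x\<close> and also meet every circle through \<open>p\<close> inside the residue, so they can be added to
  the pairwise intersecting traces of the circles of the family.  This accounts for the two
  directions missing from the \<open>q + 1\<close> directions of the residue.
\<close>

lemma card_pencil_le:
  assumes F: "two_intersecting_family circles F" and p: "p \<in> points"
  shows "card (pencil F p) \<le> q - 1"
proof -
  interpret R: affine_plane "Res p" "Lin p" using p by (rule residue_affine)
  have Fc: "F \<subseteq> circles" using F by (simp add: two_intersecting_family_def)
  have finF: "finite F" using Fc finite_circles finite_subset by blast
  obtain x where x: "x \<in> Res p" using R.three_noncollinear by blast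
  then have xp: "x \<in> points" by (simp add: residue_points_def)
  obtain g h where gh: "g \<in> classes1" "h \<in> classes2" "x \<in> g" "x \<in> h"
    using ex_class1[OF xp] ex_class2[OF xp] by blast
  have pg: "p \<notin> g" "p \<notin> h"
    using x gh by (auto simp: residue_points_def parallel_def)
  let ?g = "g \<inter> Res p" and ?h = "h \<inter> Res p" and ?T = "(\<lambda>c. c - {p}) ` pencil F p"
  have lines: "?g \<in> Lin p" "?h \<in> Lin p"
    using class_trace_line gh pg by auto
  have gh_ne: "?g \<noteq> ?h"
  proof
    assume eq: "?g = ?h"
    have "\<not> ?g \<subseteq> {x}"
      using order[OF p lines(1)] order_gt_2 card_mono[of "{x}" ?g] by auto
    then obtain y where y: "y \<in> ?g" "y \<noteq> x" by blast
    then have "y \<in> points" "y \<in> h" using eq by (auto simp: residue_points_def)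
    then show False
      using at_most_one_parallel[of x y] xp y gh by (auto simp: parallel_def)
  qed
  have T_meets: "(c - {p}) \<inter> (k \<inter> Res p) \<noteq> {} \<and> c - {p} \<noteq> k \<inter> Res p"
    if c: "c \<in> pencil F p" and k: "k \<in> {g, h}" for c k
  proof
    have cc: "c \<in> circles" "p \<in> c" using c Fc by (auto simp: pencil_def)
    have kc: "k \<in> classes1 \<union> classes2" "p \<notin> k" using k gh pg by auto
    obtain z where z: "z \<in> c" "z \<in> k" using circle_class_meet[OF cc(1) kc(1)] .
    have "z \<noteq> p" using z kc by blast
    then show "(c - {p}) \<inter> (k \<inter> Res p) \<noteq> {}"
      using z trace_of_circle[OF cc] by blast
    show "c - {p} \<noteq> k \<inter> Res p"
    proof
      assume eq: "c - {p} = k \<inter> Res p"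
      have "c - {p} \<subseteq> {z}"
        using circle_class_unique[OF cc(1) kc(1), of z] z eq by blast
      then have "card (c - {p}) \<le> 1" using card_mono[of "{z}"] by fastforce
      then show False using card_circle_minus[OF cc] order_gt_2 by simp
    qed
  qed
  have T_pair: "(c - {p}) \<inter> (d - {p}) \<noteq> {}"
    if cd: "c \<in> pencil F p" "d \<in> pencil F p" "c \<noteq> d" for c d
  proof
    assume "(c - {p}) \<inter> (d - {p}) = {}"
    then have "c \<inter> d \<subseteq> {p}" by blast
    then have "card (c \<inter> d) \<le> 1" using card_mono[of "{p}"] by fastforce
    then show False using card_Int_eq_2[OF F, of c d] cd by (auto simp: pencil_def)
  qed
  have "card (insert ?g (insert ?h ?T)) \<le> q + 1"
  proof (rule R.card_pairwise_meeting_le)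
    show "card l = q" if "l \<in> Lin p" for l using order[OF p that] .
    show "insert ?g (insert ?h ?T) \<subseteq> Lin p"
      using lines circle_trace_line Fc by (auto simp: pencil_def)
    have x': "?g \<inter> ?h \<noteq> {}" using x gh by blast
    have gT: "?g \<inter> l \<noteq> {}" "l \<inter> ?g \<noteq> {}" and hT: "?h \<inter> l \<noteq> {}" "l \<inter> ?h \<noteq> {}"
      if "l \<in> ?T" for l
      using that T_meets by blast+
    have TT: "l \<inter> k \<noteq> {}" if lk: "l \<in> ?T" "k \<in> ?T" and ne: "l \<noteq> k" for l k
    proof -
      obtain c d where "c \<in> pencil F p" "l = c - {p}" "d \<in> pencil F p" "k = d - {p}"
        using lk by blast
      then show ?thesis using T_pair[of c d] ne by blast
    qed
    show "l \<inter> k \<noteq> {}"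
      if l: "l \<in> insert ?g (insert ?h ?T)" and k: "k \<in> insert ?g (insert ?h ?T)" and ne: "l \<noteq> k"
      for l k
    proof -
      consider "l = ?g" | "l = ?h" | "l \<in> ?T" using l by blast
      then show ?thesis
      proof cases
        case 1
        consider "k = ?h" | "k \<in> ?T" using k ne 1 by blast
        then show ?thesis using 1 x' gT(1) by cases simp_all
      next
        case 2
        consider "k = ?g" | "k \<in> ?T" using k ne 2 by blast
        then show ?thesis using 2 x' hT(1) by cases (simp_all add: Int_commute)
      next
        case 3
        consider "k = ?g" | "k = ?h" | "k \<in> ?T" using k by blast
        then show ?thesis using 3 gT(2) hT(2) TT ne by cases simp_all
      qed
    qed
  qed
  moreover have "card (insert ?g (insert ?h ?T)) = card ?T + 2"
  proof -
    have "?g \<notin> ?T" "?h \<notin> ?T" using T_meets by auto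
    moreover have "finite ?T" using finF by (simp add: pencil_def)
    ultimately show ?thesis using gh_ne by simp
  qed
  moreover have "card ?T = card (pencil F p)"
    by (rule card_image) (auto simp: inj_on_def pencil_def)
  ultimately show ?thesis by simp
qed

lemma sum_card_pencil_circle:
  assumes F: "two_intersecting_family circles F" and c: "c \<in> F"
  shows "(\<Sum>p\<in>c. card (pencil F p)) = (q + 1) + 2 * (card F - 1)"
proof -
  have Fc: "F \<subseteq> circles" using F by (simp add: two_intersecting_family_def)
  have finF: "finite F" using Fc finite_circles finite_subset by blast
  have cc: "c \<in> circles" using c Fc by blast
  have "(\<Sum>p\<in>c. card (pencil F p)) = (\<Sum>d\<in>F. card (d \<inter> c))"
    using sum_card_pencil finite_circle[OF cc] finF by blast
  also have "\<dots> = card (c \<inter> c) + (\<Sum>d\<in>F - {c}. card (d \<inter> c))"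
    using finF c by (simp add: sum.remove)
  also have "(\<Sum>d\<in>F - {c}. card (d \<inter> c)) = (\<Sum>d\<in>F - {c}. 2)"
    by (rule sum.cong) (use card_Int_eq_2[OF F] c in auto)
  finally show ?thesis using card_circle[OF cc] c finF by simp
qed

text \<open>
  If the bound from counting along a single circle is attained, no point of that circle can have
  fewer than \<open>q - 1\<close> circles of the family.
\<close>

lemma card_family_le:
  assumes F: "two_intersecting_family circles F" and c: "c \<in> F"
  shows "2 * card F \<le> q * (q - 1)"
    and "\<lbrakk>2 * card F = q * (q - 1); p \<in> c\<rbrakk> \<Longrightarrow> card (pencil F p) = q - 1"
proof -
  have Fc: "F \<subseteq> circles" using F by (simp add: two_intersecting_family_def)
  have cc: "c \<in> circles" using c Fc by blast
  have finF: "finite F" using Fc finite_circles finite_subset by blast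
  have pos: "card F > 0" using c finF card_gt_0_iff by blast
  have le: "card (pencil F p) \<le> q - 1" if "p \<in> c" for p
    using card_pencil_le[OF F] circle_subset[OF cc] that by blast
  have total: "(\<Sum>p\<in>c. q - 1) = (q + 1) * (q - 1)"
    using card_circle[OF cc] by simp
  have "(q + 1) + 2 * (card F - 1) \<le> (q + 1) * (q - 1)"
    using sum_mono[of c "\<lambda>p. card (pencil F p)" "\<lambda>_. q - 1"] le
    unfolding sum_card_pencil_circle[OF F c] total by blast
  then show "2 * card F \<le> q * (q - 1)" using order_gt_2 pos by (simp add: algebra_simps)
  show "card (pencil F p) = q - 1" if eq: "2 * card F = q * (q - 1)" and p: "p \<in> c"
  proof (rule ccontr)
    assume "card (pencil F p) \<noteq> q - 1"
    then have "card (pencil F p) < q - 1" using le[OF p] by simp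
    then have "(\<Sum>p\<in>c. card (pencil F p)) < (\<Sum>p\<in>c. q - 1)"
      using le p by (intro sum_strict_mono_ex1[OF finite_circle[OF cc]]) blast+
    then show False unfolding sum_card_pencil_circle[OF F c] total
      using eq order_gt_2 pos by (simp add: algebra_simps)
  qed
qed

section \<open>The case of equality\<close>

lemma sum_card_pencil_Res:
  assumes F: "F \<subseteq> circles" and p: "p \<in> points"
  shows "(\<Sum>x\<in>Res p. card (pencil F x)) = card F * (q - 1) + card (pencil F p)"
proof -
  have finF: "finite F" using F finite_circles finite_subset by blast
  have "(\<Sum>x\<in>Res p. card (pencil F x)) = (\<Sum>d\<in>F. card (d \<inter> Res p))"
    using sum_card_pencil finite_Res finF by blast
  also have "\<dots> = (\<Sum>d\<in>F. (q - 1) + (if p \<in> d then 1 else 0))"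
  proof (rule sum.cong)
    fix d assume "d \<in> F"
    then show "card (d \<inter> Res p) = (q - 1) + (if p \<in> d then 1 else 0)"
      using F p trace_of_circle[of d p] card_circle_minus[of d p] card_trace_off_point[of d p]
        order_gt_2 by auto
  qed simp
  also have "\<dots> = card F * (q - 1) + card (pencil F p)"
    using finF by (simp add: sum.distrib sum.If_cases pencil_def Int_def)
  finally show ?thesis .
qed

lemma sum_card_pencil_pencil:
  assumes F: "F \<subseteq> circles"
  shows "(\<Sum>x\<in>Res p. card (pencil (pencil F p) x)) = card (pencil F p) * q"
proof -
  have fin: "finite (pencil F p)"
    using F finite_circles finite_subset pencil_subset by (metis subset_trans)
  have "(\<Sum>x\<in>Res p. card (pencil (pencil F p) x)) = (\<Sum>d\<in>pencil F p. card (d \<inter> Res p))"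
    using sum_card_pencil finite_Res fin by blast
  also have "\<dots> = (\<Sum>d\<in>pencil F p. q)"
    by (rule sum.cong) (use F trace_of_circle card_circle_minus in \<open>auto simp: pencil_def\<close>)
  finally show ?thesis by simp
qed

text \<open>
  The left-hand side counts ordered pairs of circles of \<open>F\<close> through \<open>p\<close> together with a common
  point in the residue: a circle shares \<open>q\<close> such points with itself and one with each other circle.
\<close>

lemma sum_card_pencil_pencil_squared:
  assumes F: "two_intersecting_family circles F"
  shows "(\<Sum>x\<in>Res p. (card (pencil (pencil F p) x))\<^sup>2)
      = card (pencil F p) * (q + (card (pencil F p) - 1))"
proof -
  let ?G = "pencil F p"
  have Fc: "F \<subseteq> circles" using F by (simp add: two_intersecting_family_def)
  have fin: "finite ?G"
    using Fc finite_circles finite_subset pencil_subset by (metis subset_trans)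
  have "(\<Sum>x\<in>Res p. (card (pencil ?G x))\<^sup>2) = (\<Sum>d\<in>?G. \<Sum>e\<in>?G. card (d \<inter> e \<inter> Res p))"
    using sum_card_pencil_squared finite_Res fin by blast
  also have "\<dots> = (\<Sum>d\<in>?G. q + (card ?G - 1))"
  proof (rule sum.cong)
    fix d assume d: "d \<in> ?G"
    then have dd: "d \<in> circles" "p \<in> d" using Fc by (auto simp: pencil_def)
    have "(\<Sum>e\<in>?G. card (d \<inter> e \<inter> Res p))
        = card (d \<inter> d \<inter> Res p) + (\<Sum>e\<in>?G - {d}. card (d \<inter> e \<inter> Res p))"
      using fin d by (simp add: sum.remove)
    also have "card (d \<inter> d \<inter> Res p) = q"
      using trace_of_circle[OF dd] card_circle_minus[OF dd] by simp
    also have "(\<Sum>e\<in>?G - {d}. card (d \<inter> e \<inter> Res p)) = (\<Sum>e\<in>?G - {d}. 1)"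
    proof (rule sum.cong)
      fix e assume e: "e \<in> ?G - {d}"
      then have "card (d \<inter> e) = 2"
        using card_Int_eq_2[OF F, of d e] d by (auto simp: pencil_def)
      moreover have "d \<inter> e \<inter> Res p = d \<inter> e - {p}"
        using trace_of_circle[OF dd] by blast
      ultimately show "card (d \<inter> e \<inter> Res p) = 1"
        using d e by (simp add: pencil_def)
    qed simp
    finally show "(\<Sum>e\<in>?G. card (d \<inter> e \<inter> Res p)) = q + (card ?G - 1)"
      using fin d by simp
  qed simp
  finally show ?thesis by simp
qed

text \<open>
  The inequality \<open>(\<lambda>\<^sub>x - 1) (\<lambda>\<^sub>x - 2) \<ge> 0\<close> is only to be summed over the covered points \<open>x\<close>.
  Multiplied by \<open>q - 1\<close>, its constant term becomes \<open>2 r\<^sub>x\<close> there, and with \<open>2 r\<^sub>x\<close> in place of the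
  constant it is trivially true at uncovered points, where \<open>r\<^sub>x = \<lambda>\<^sub>x = 0\<close>.  So the sum can be
  taken over the whole residue.
\<close>

lemma card_family_ne:
  assumes F: "two_intersecting_family circles F" and c: "c \<in> F"
  shows "2 * card F \<noteq> q * (q - 1)"
proof
  assume eq: "2 * card F = q * (q - 1)"
  have Fc: "F \<subseteq> circles" using F by (simp add: two_intersecting_family_def)
  obtain p where pc: "p \<in> c" using circle_nonempty c Fc by blast
  have p: "p \<in> points" using pc c Fc circle_subset by blast
  have rp: "card (pencil F p) = q - 1" using card_family_le(2)[OF F c eq pc] .
  define r where "r x = int (card (pencil F x))" for x
  define l where "l x = int (card (pencil (pencil F p) x))" for x
  define k where "k = int q - 1"
  have k: "int (q - 1) = k" "int q = k + 1" "k > 1" using order_gt_2 by (auto simp: k_def)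
  have nonneg: "0 \<le> k * ((l x)\<^sup>2 - 3 * l x) + 2 * r x" for x
  proof (cases "pencil F x = {}")
    case True
    then have "pencil (pencil F p) x = {}" by (auto simp: pencil_def)
    then show ?thesis using True by (simp add: l_def r_def)
  next
    case False
    then obtain d where "d \<in> F" "x \<in> d" by (auto simp: pencil_def)
    then have "r x = k" using card_family_le(2)[OF F _ eq] k by (simp add: r_def)
    then have "k * ((l x)\<^sup>2 - 3 * l x) + 2 * r x = k * ((l x - 1) * (l x - 2))"
      by (simp add: algebra_simps power2_eq_square)
    moreover have "(l x - 1) * (l x - 2) \<ge> 0"
    proof (cases "l x \<le> 1")
      case True
      then show ?thesis by (intro mult_nonpos_nonpos) auto
    next
      case False
      then show ?thesis by simp
    qed
    ultimately show ?thesis using k by simp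
  qed
  have "(\<Sum>x\<in>Res p. r x) = int (card F * (q - 1) + card (pencil F p))"
    unfolding r_def sum_card_pencil_Res[OF Fc p, symmetric] by simp
  then have sum_r: "(\<Sum>x\<in>Res p. r x) = int (card F) * k + k"
    using rp k by simp
  have "(\<Sum>x\<in>Res p. l x) = int (card (pencil F p) * q)"
    unfolding l_def sum_card_pencil_pencil[OF Fc, symmetric] by simp
  then have sum_l: "(\<Sum>x\<in>Res p. l x) = k * (k + 1)"
    using rp k by simp
  have "(\<Sum>x\<in>Res p. (l x)\<^sup>2) = int (card (pencil F p) * (q + (card (pencil F p) - 1)))"
    unfolding l_def sum_card_pencil_pencil_squared[OF F, symmetric] by simp
  moreover have "int (q + (q - 1 - 1)) = 2 * k"
    using order_gt_2 unfolding k_def by presburger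
  ultimately have sum_l2: "(\<Sum>x\<in>Res p. (l x)\<^sup>2) = k * (2 * k)"
    unfolding rp by (simp only: of_nat_mult k(1))
  have f: "2 * int (card F) = (k + 1) * k"
    using arg_cong[OF eq, of int] by (simp only: of_nat_mult of_nat_numeral k)
  have "0 \<le> (\<Sum>x\<in>Res p. k * ((l x)\<^sup>2 - 3 * l x) + 2 * r x)"
    by (rule sum_nonneg) (rule nonneg)
  also have "\<dots> = k * ((\<Sum>x\<in>Res p. (l x)\<^sup>2) - 3 * (\<Sum>x\<in>Res p. l x)) + 2 * (\<Sum>x\<in>Res p. r x)"
    by (simp add: sum.distrib sum_subtractf sum_distrib_left[symmetric])
  also have "\<dots> = k * (k * (2 * k) - 3 * (k * (k + 1))) + (2 * int (card F)) * k + 2 * k"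
    unfolding sum_l sum_l2 sum_r by (simp add: algebra_simps)
  also have "\<dots> = k * (2 - 2 * k)"
    unfolding f by (simp add: algebra_simps)
  also have "\<dots> < 0" using k by (simp add: mult_pos_neg)
  finally show False by simp
qed

end

theorem theorem7p2:
  fixes points :: "'a set" and circles classes1 classes2 F :: "'a set set" and q :: nat
  assumes "minkowski_plane_of_order points circles classes1 classes2 q"
    and "q > 2"
    and "two_intersecting_family circles F"
  shows "real (card F) \<le> (real q + 1) * ((real q - 2) / 2)"
proof (cases "F = {}")
  case True
  then show ?thesis using assms(2) by simp
next
  case False
  then obtain c where c: "c \<in> F" by blast
  interpret minkowski_plane points circles classes1 classes2
    using assms(1) by (simp add: minkowski_plane_of_order_def)
  interpret minkowski_plane_with_order points circles classes1 classes2 q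
    using assms(1,2)
    by unfold_locales (auto simp: minkowski_plane_of_order_def affine_plane_of_order_def)
  have "2 * card F < q * (q - 1)"
    using card_family_le(1)[OF assms(3) c] card_family_ne[OF assms(3) c] by simp
  \<comment> \<open>Both sides are even, so strictness gains \<open>2\<close> and not just \<open>1\<close>.\<close>
  moreover have "even (q * (q - 1))" by (cases q) auto
  ultimately have "2 * card F + 2 \<le> q * (q - 1)" by presburger
  then have "real (2 * card F + 2) \<le> real (q * (q - 1))" by (rule of_nat_mono)
  then show ?thesis using assms(2) by (simp add: of_nat_diff field_simps)
qed

end
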